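(* For every $t\in[0,T]$ the system matrix $A=A(t)\in\mathbb{R}^{n\times n}$ of the semi-discretized heat equation $\frac{dY(t)}{dt}=A(t)Y(t)+B(t)g(t)$ (defined in the context) is stable, i.e., all eigenvalues $\lambda(A(t))$ lie in the open left complex half plane $\{z\in\mathbb{C}:\operatorname{Re} z<0\}$.
   Context: Parameters. $T,l_x,l_y>0$; positive constants $\rho^M,\kappa^M,c_p^M$ (medium) and $\rho^F,\kappa^F,c_p^F$ (fluid); $a^M=\frac{\kappa^M}{\rho^M c_p^M}$, $a^F=\frac{\kappa^F}{\rho^F c_p^F}$; $\lambda^G>0$; $\overline v_0>0$. The fluid velocity $v_0:[0,T]\to\{0,\overline v_0\}$ is piecewise constant; the pump is "on" at time $t$ if $v_0(t)=\overline v_0$ and "off" if $v_0(t)=0$. Put $\psi^F=\frac{\kappa^F}{\kappa^F+\kappa^M}$, $\psi^M=1-\psi^F$. Grid. $h_x=l_x/N_x$, $h_y=l_y/N_y$ with positive integers $N_x\ge 3$, $N_y$; grid points $(x_i,y_j)=(ih_x,jh_y)$, $0\le i\le N_x$, $0\le j\le N_y$. There are $n_P\in\mathbb{N}$ straight horizontal pipe heat exchangers crossing the rectangle $(0,l_x)\times(0,l_y)$, in which the fluid moves in positive $x$-direction (with velocity $v_0(t)(1,0)^\top$). Each row index $j\in\{1,\dots,N_y-1\}$ is a medium row, a fluid row or an interface row. From bottom to top the rows form: a nonempty layer of medium rows, then, repeated $n_P$ times, one lower interface row, a nonempty layer of fluid rows, one upper interface row, and a nonempty layer of medium rows. Let $\mathcal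 J$ be the set of non-interface rows, $q=|\mathcal J|=N_y-2n_P-1$, $n=(N_x-1)q$. The unknown vector $Y(t)\in\mathbb{R}^n$ has entries $Y_l=Q_{ij}$, $1\le i\le N_x-1$, $j\in\mathcal J$, where $l=\mathcal K(i,j)=(i-1)q+(\text{position of } j \text{ in the increasing ordering of } \mathcal J)$. Semi-discrete scheme. For $1\le i\le N_x-1$, $j\in\mathcal J$, $$\frac{dQ_{ij}}{dt}=\alpha_j^{+}Q_{i+1,j}+\alpha_j^{-}Q_{i-1,j}+\beta_jQ_{i,j+1}+\beta_jQ_{i,j-1}+\gamma_jQ_{ij},$$ where for a medium row $\alpha_j^{\pm}=\frac{a^M}{h_x^2}$, $\beta_j=\frac{a^M}{h_y^2}$, $\gamma_j=-2a^M\big(\frac1{h_x^2}+\frac1{h_y^2}\big)$, and for a fluid row $\alpha_j^+=\frac{a^F}{h_x^2}$, $\alpha_j^-=\frac{a^F}{h_x^2}+\frac{v_0(t)}{h_x}$, $\beta_j=\frac{a^F}{h_y^2}$, $\gamma_j=-2a^F\big(\frac1{h_x^2}+\frac1{h_y^2}\big)-\frac{v_0(t)}{h_x}$. Boundary and interface values occurring on the right-hand side are eliminated by substituting: - top: $Q_{i,N_y}=Q_{i,N_y-1}$; - bottom: $Q_{i0}=\frac{\kappa^M}{\kappa^M+\lambda^Gh_y}Q_{i1}+\frac{\lambda^Gh_y}{\kappa^M+\lambda^Gh_y}Q^G(t)$; - right boundary (all $j\in\mathcal J$): $Q_{N_x,j}=Q_{N_x-1,j}$; - left boundary, medium row $j$: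 $Q_{0j}=Q_{1j}$; - left boundary (inlet), fluid row $j$: $Q_{0j}=Q^I(t)$ if the pump is on, $Q_{0j}=Q_{1j}$ if the pump is off; - lower interface row $j$: $Q_{ij}=\psi^FQ_{i,j+1}+\psi^MQ_{i,j-1}$; - upper interface row $j$: $Q_{ij}=\psi^FQ_{i,j-1}+\psi^MQ_{i,j+1}$. Here $Q^I(t)$ (inlet temperature) and $Q^G(t)$ (underground temperature) are given real functions. The resulting linear ODE system is written $\frac{dY}{dt}=A(t)Y+B(t)g(t)$, where $A(t)\in\mathbb{R}^{n\times n}$ collects the coefficients of the unknowns, $g(t)=(Q^I(t),Q^G(t))^\top$ if the pump is on and $g(t)=(0,Q^G(t))^\top$ if it is off, and $B(t)\in\mathbb{R}^{n\times2}$ has entries $B_{l1}=\frac{a^F}{h_x^2}+\frac{\overline v_0}{h_x}$ if the pump is on and $0$ if it is off, for $l=\mathcal K(1,j)$ with $j$ a fluid row; $B_{l2}=\frac{\lambda^Gh_y}{\kappa^M+\lambda^Gh_y}\cdot\frac{a^M}{h_y^2}$ for $l=\mathcal K(i,1)$, $1\le i\le N_x-1$; all other entries zero. *)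

theory Defs
  imports "Jordan_Normal_Form.Spectral_Radius"
begin

datatype row_kind = Medium | Fluid | LowerInterface | UpperInterface

definition interface :: "row_kind \<Rightarrow> bool" where
  "interface r \<longleftrightarrow> r = LowerInterface \<or> r = UpperInterface"

lemma interface_simps [simp]:
  "\<not> interface Medium" "\<not> interface Fluid" "interface LowerInterface" "interface UpperInterface"
  by (auto simp: interface_def)

(* Superscripts M, F, G, I are rendered as _M, _F, _G, _I; lam_G is lambda^G, v_bar is the
   velocity of the running pump, t_end is T.  row_type j is meaningful for 1 <= j <= N_y - 1. *)
record heat_model =
  t_end :: real
  l_x :: real
  l_y :: real
  rho_M :: real
  kappa_M :: real
  c_M :: real
  rho_F :: real
  kappa_F :: real
  c_F :: real
  lam_G :: real
  v_bar :: real
  v_0 :: "real \<Rightarrow> real"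
  Q_I :: "real \<Rightarrow> real"
  Q_G :: "real \<Rightarrow> real"
  N_x :: nat
  N_y :: nat
  n_P :: nat
  row_type :: "nat \<Rightarrow> row_kind"

definition piecewise_constant_on :: "real \<Rightarrow> real \<Rightarrow> (real \<Rightarrow> 'a) \<Rightarrow> bool" where
  "piecewise_constant_on a b f \<longleftrightarrow>
     (\<exists>D. finite D \<and> (\<forall>s t. a \<le> s \<and> s \<le> t \<and> t \<le> b \<and> {s..t} \<inter> D = {} \<longrightarrow> f s = f t))"

(* The kinds of the rows 1, ..., N_y - 1 from bottom to top, for m pipes.  b is the thickness of
   the lowest medium layer; each pair (f, k) stands for one pipe with f fluid rows, together with
   the k medium rows above it. *)
definition pipe_layout :: "nat \<Rightarrow> row_kind list \<Rightarrow> bool" where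
  "pipe_layout m kinds \<longleftrightarrow>
     (\<exists>b layers. b \<ge> 1 \<and> length layers = m \<and> (\<forall>(f, k) \<in> set layers. f \<ge> 1 \<and> k \<ge> 1) \<and>
        kinds = replicate b Medium @
          concat (map (\<lambda>(f, k). LowerInterface # replicate f Fluid @
                                UpperInterface # replicate k Medium) layers))"

definition admissible :: "heat_model \<Rightarrow> bool" where
  "admissible P \<longleftrightarrow>
     t_end P > 0 \<and> l_x P > 0 \<and> l_y P > 0 \<and>
     rho_M P > 0 \<and> kappa_M P > 0 \<and> c_M P > 0 \<and>
     rho_F P > 0 \<and> kappa_F P > 0 \<and> c_F P > 0 \<and>
     lam_G P > 0 \<and> v_bar P > 0 \<and>
     (\<forall>t\<in>{0..t_end P}. v_0 P t \<in> {0, v_bar P}) \<and>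
     piecewise_constant_on 0 (t_end P) (v_0 P) \<and>
     N_x P \<ge> 3 \<and> N_y P \<ge> 1 \<and>
     pipe_layout (n_P P) (map (row_type P) [1..<N_y P])"

definition a_M :: "heat_model \<Rightarrow> real" where
  "a_M P = kappa_M P / (rho_M P * c_M P)"

definition a_F :: "heat_model \<Rightarrow> real" where
  "a_F P = kappa_F P / (rho_F P * c_F P)"

definition psi_F :: "heat_model \<Rightarrow> real" where
  "psi_F P = kappa_F P / (kappa_F P + kappa_M P)"

definition psi_M :: "heat_model \<Rightarrow> real" where
  "psi_M P = 1 - psi_F P"

definition h_x :: "heat_model \<Rightarrow> real" where
  "h_x P = l_x P / real (N_x P)"

definition h_y :: "heat_model \<Rightarrow> real" where
  "h_y P = l_y P / real (N_y P)"

definition pump_on :: "heat_model \<Rightarrow> real \<Rightarrow> bool" where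
  "pump_on P t \<longleftrightarrow> v_0 P t = v_bar P"

definition J_rows :: "heat_model \<Rightarrow> nat set" where
  "J_rows P = {j. 1 \<le> j \<and> j < N_y P \<and> \<not> interface (row_type P j)}"

definition q_rows :: "heat_model \<Rightarrow> nat" where
  "q_rows P = card (J_rows P)"

definition dim_Y :: "heat_model \<Rightarrow> nat" where
  "dim_Y P = (N_x P - 1) * q_rows P"

(* Vector entries are counted from 0, so K_index P i j is K(i,j) - 1. *)
definition K_index :: "heat_model \<Rightarrow> nat \<Rightarrow> nat \<Rightarrow> nat" where
  "K_index P i j = (i - 1) * q_rows P + card {k \<in> J_rows P. k < j}"

(* The grid point (i, j) with K_index P i j = l. *)
definition col_of :: "heat_model \<Rightarrow> nat \<Rightarrow> nat" where
  "col_of P l = l div q_rows P + 1"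

definition row_of :: "heat_model \<Rightarrow> nat \<Rightarrow> nat" where
  "row_of P l = sorted_list_of_set (J_rows P) ! (l mod q_rows P)"

definition unknown :: "heat_model \<Rightarrow> real vec \<Rightarrow> nat \<Rightarrow> nat \<Rightarrow> real" where
  "unknown P Y i j = Y $ K_index P i j"

(* Q_{ij} at time t in terms of the unknowns Y, after the boundary and interface substitutions.
   The points with i = 0 or i = N_x that lie on the top or bottom boundary or on an interface row
   do not occur in the scheme; the values given there are irrelevant. *)
definition grid_value :: "heat_model \<Rightarrow> real \<Rightarrow> real vec \<Rightarrow> nat \<Rightarrow> nat \<Rightarrow> real" where
  "grid_value P t Y i j =
    (if j = 0 then
       kappa_M P / (kappa_M P + lam_G P * h_y P) * unknown P Y i 1
       + lam_G P * h_y P / (kappa_M P + lam_G P * h_y P) * Q_G P t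
     else if j = N_y P then unknown P Y i (N_y P - 1)
     else if row_type P j = LowerInterface then
       psi_F P * unknown P Y i (j + 1) + psi_M P * unknown P Y i (j - 1)
     else if row_type P j = UpperInterface then
       psi_F P * unknown P Y i (j - 1) + psi_M P * unknown P Y i (j + 1)
     else if i = 0 then
       (if row_type P j = Fluid \<and> pump_on P t then Q_I P t else unknown P Y 1 j)
     else if i = N_x P then unknown P Y (N_x P - 1) j
     else unknown P Y i j)"

definition alpha_plus :: "heat_model \<Rightarrow> nat \<Rightarrow> real" where
  "alpha_plus P j = (if row_type P j = Fluid then a_F P / (h_x P)\<^sup>2 else a_M P / (h_x P)\<^sup>2)"

definition alpha_minus :: "heat_model \<Rightarrow> real \<Rightarrow> nat \<Rightarrow> real" where
  "alpha_minus P t j =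
     (if row_type P j = Fluid then a_F P / (h_x P)\<^sup>2 + v_0 P t / h_x P else a_M P / (h_x P)\<^sup>2)"

definition beta :: "heat_model \<Rightarrow> nat \<Rightarrow> real" where
  "beta P j = (if row_type P j = Fluid then a_F P / (h_y P)\<^sup>2 else a_M P / (h_y P)\<^sup>2)"

definition gamma :: "heat_model \<Rightarrow> real \<Rightarrow> nat \<Rightarrow> real" where
  "gamma P t j =
     (if row_type P j = Fluid
      then - 2 * a_F P * (1 / (h_x P)\<^sup>2 + 1 / (h_y P)\<^sup>2) - v_0 P t / h_x P
      else - 2 * a_M P * (1 / (h_x P)\<^sup>2 + 1 / (h_y P)\<^sup>2))"

definition scheme_rhs :: "heat_model \<Rightarrow> real \<Rightarrow> real vec \<Rightarrow> nat \<Rightarrow> nat \<Rightarrow> real" where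
  "scheme_rhs P t Y i j =
     alpha_plus P j * grid_value P t Y (i + 1) j
     + alpha_minus P t j * grid_value P t Y (i - 1) j
     + beta P j * grid_value P t Y i (j + 1)
     + beta P j * grid_value P t Y i (j - 1)
     + gamma P t j * grid_value P t Y i j"

definition rhs_vec :: "heat_model \<Rightarrow> real \<Rightarrow> real vec \<Rightarrow> real vec" where
  "rhs_vec P t Y = vec (dim_Y P) (\<lambda>l. scheme_rhs P t Y (col_of P l) (row_of P l))"

(* rhs_vec P t is affine in Y; the entry (l, k) is the coefficient of the k-th unknown in the
   l-th equation (see rhs_vec_eq below). *)
definition system_matrix :: "heat_model \<Rightarrow> real \<Rightarrow> real mat" where
  "system_matrix P t = mat (dim_Y P) (dim_Y P)
     (\<lambda>(l, k). rhs_vec P t (unit_vec (dim_Y P) k) $ l - rhs_vec P t (0\<^sub>v (dim_Y P)) $ l)"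

definition input_matrix :: "heat_model \<Rightarrow> real \<Rightarrow> real mat" where
  "input_matrix P t = mat (dim_Y P) 2 (\<lambda>(l, c).
     if c = 0 then
       (if pump_on P t \<and> col_of P l = 1 \<and> row_type P (row_of P l) = Fluid
        then a_F P / (h_x P)\<^sup>2 + v_bar P / h_x P else 0)
     else
       (if row_of P l = 1
        then lam_G P * h_y P / (kappa_M P + lam_G P * h_y P) * (a_M P / (h_y P)\<^sup>2) else 0))"

definition input_vec :: "heat_model \<Rightarrow> real \<Rightarrow> real vec" where
  "input_vec P t = vec_of_list [if pump_on P t then Q_I P t else 0, Q_G P t]"

definition stable_matrix :: "real mat \<Rightarrow> bool" where
  "stable_matrix A \<longleftrightarrow> (\<forall>z \<in> spectrum (map_mat complex_of_real A). Re z < 0)"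

lemma pipe_layout_props:
  assumes "pipe_layout m kinds"
  shows "kinds \<noteq> [] \<and> hd kinds = Medium \<and> last kinds = Medium \<and>
         successively (\<lambda>a b. \<not> (interface a \<and> interface b)) kinds \<and>
         length (filter (\<lambda>r. \<not> interface r) kinds) + 2 * m = length kinds"
proof -
  let ?S = "successively (\<lambda>a b. \<not> (interface a \<and> interface b))"
  let ?seg = "\<lambda>(f, k). LowerInterface # replicate f Fluid @ UpperInterface # replicate k Medium"
  obtain b layers where b: "b \<ge> 1" and m: "length layers = m"
    and l: "\<forall>(f, k) \<in> set layers. f \<ge> 1 \<and> k \<ge> 1"
    and kinds: "kinds = replicate b Medium @ concat (map ?seg layers)"
    using assms unfolding pipe_layout_def by blast
  have rep: "?S (replicate c r)" if "\<not> interface r" for c r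
    using that by (induction c) (auto simp: successively_Cons)
  have "replicate b Medium @ concat (map ?seg layers) \<noteq> [] \<and>
        hd (replicate b Medium @ concat (map ?seg layers)) = Medium \<and>
        last (replicate b Medium @ concat (map ?seg layers)) = Medium \<and>
        ?S (replicate b Medium @ concat (map ?seg layers)) \<and>
        length (filter (\<lambda>r. \<not> interface r) (replicate b Medium @ concat (map ?seg layers)))
          + 2 * length layers = length (replicate b Medium @ concat (map ?seg layers))"
    using l
  proof (induction layers rule: rev_induct)
    case Nil
    show ?case using b by (auto simp: rep[simplified])
  next
    case (snoc s layers)
    obtain f k where s: "s = (f, k)" by force
    define xs where "xs = replicate b Medium @ concat (map ?seg layers)"
    have IH: "xs \<noteq> []" "hd xs = Medium" "last xs = Medium" "?S xs"
      "length (filter (\<lambda>r. \<not> interface r) xs) + 2 * length layers = length xs"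
      using snoc unfolding xs_def by auto
    have fk: "f \<ge> 1" "k \<ge> 1" using snoc.prems s by auto
    have eq: "replicate b Medium @ concat (map ?seg (layers @ [s])) = xs @ ?seg (f, k)"
      unfolding xs_def s by simp
    show ?case unfolding eq using IH fk
      by (auto simp: successively_append_iff successively_Cons rep[simplified])
  qed
  then show ?thesis unfolding kinds[symmetric] m .
qed

lemma admissible_rows:
  assumes "admissible P"
  shows "N_y P \<ge> 2" "row_type P 1 = Medium" "row_type P (N_y P - 1) = Medium"
    and "\<And>j. 1 \<le> j \<Longrightarrow> j + 1 < N_y P \<Longrightarrow>
           \<not> (interface (row_type P j) \<and> interface (row_type P (j + 1)))"
    and "q_rows P = N_y P - 2 * n_P P - 1"
proof -
  let ?r = "map (row_type P) [1..<N_y P]"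
  have L: "pipe_layout (n_P P) ?r" using assms unfolding admissible_def by blast
  note p = pipe_layout_props[OF L]
  show N: "N_y P \<ge> 2" using p by auto
  show "row_type P 1 = Medium" using p N by (auto simp: hd_map)
  show "row_type P (N_y P - 1) = Medium" using p N by (auto simp: last_map)
  show "\<not> (interface (row_type P j) \<and> interface (row_type P (j + 1)))"
    if "1 \<le> j" "j + 1 < N_y P" for j
  proof -
    have "\<not> (interface (?r ! (j - 1)) \<and> interface (?r ! Suc (j - 1)))"
    proof -
      have "Suc (j - 1) < length ?r" using that by simp
      then show ?thesis using p unfolding successively_conv_nth by blast
    qed
    then show ?thesis using that by auto
  qed
  have "J_rows P = set (filter (\<lambda>j. \<not> interface (row_type P j)) [1..<N_y P])"
    unfolding J_rows_def by auto
  then have "q_rows P = length (filter (\<lambda>j. \<not> interface (row_type P j)) [1..<N_y P])"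
    unfolding q_rows_def by (metis distinct_card distinct_filter distinct_upt)
  also have "\<dots> = length (filter (\<lambda>r. \<not> interface r) ?r)"
    by (simp add: filter_map o_def)
  finally show "q_rows P = N_y P - 2 * n_P P - 1" using p by (simp; linarith)
qed

lemma finite_J_rows [simp]: "finite (J_rows P)"
  unfolding J_rows_def by auto

lemma K_index_less:
  assumes "1 \<le> i" "i < N_x P" "j \<in> J_rows P"
  shows "K_index P i j < dim_Y P"
proof -
  have "card {k \<in> J_rows P. k < j} < q_rows P"
    unfolding q_rows_def using assms(3) by (intro psubset_card_mono) auto
  then have "K_index P i j < (i - 1) * q_rows P + q_rows P" unfolding K_index_def by simp
  also have "\<dots> = i * q_rows P" using assms(1) by (cases i) auto
  also have "\<dots> \<le> dim_Y P" unfolding dim_Y_def using assms(2) by (intro mult_right_mono) auto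
  finally show ?thesis .
qed

lemma col_row_of:
  assumes "l < dim_Y P"
  shows "1 \<le> col_of P l" "col_of P l < N_x P" "row_of P l \<in> J_rows P"
    and "K_index P (col_of P l) (row_of P l) = l"
proof -
  have q: "q_rows P > 0" using assms unfolding dim_Y_def by (cases "q_rows P") auto
  show "1 \<le> col_of P l" unfolding col_of_def by simp
  have "l div q_rows P < N_x P - 1"
    using assms q unfolding dim_Y_def by (simp add: less_mult_imp_div_less)
  then show "col_of P l < N_x P" unfolding col_of_def by simp
  let ?s = "sorted_list_of_set (J_rows P)"
  have len: "length ?s = q_rows P" unfolding q_rows_def by simp
  have m: "l mod q_rows P < q_rows P" using q by simp
  then have "row_of P l \<in> set ?s" unfolding row_of_def using len by (metis nth_mem)
  then show "row_of P l \<in> J_rows P" by simp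
  have sd: "sorted_wrt (<) ?s" by (rule strict_sorted_list_of_set)
  have "{k \<in> J_rows P. k < row_of P l} = (!) ?s ` {..<l mod q_rows P}"
  proof (intro equalityI subsetI)
    fix k assume k: "k \<in> {k \<in> J_rows P. k < row_of P l}"
    then obtain u where u: "u < q_rows P" "k = ?s ! u"
      by (metis (lifting) finite_J_rows in_set_conv_nth len mem_Collect_eq set_sorted_list_of_set)
    have "u < l mod q_rows P"
    proof (rule ccontr)
      assume "\<not> u < l mod q_rows P"
      then have "?s ! (l mod q_rows P) \<le> ?s ! u"
        using u(1) len by (intro sorted_nth_mono sorted_sorted_list_of_set) auto
      then show False using k u unfolding row_of_def by simp
    qed
    then show "k \<in> (!) ?s ` {..<l mod q_rows P}" using u by auto
  next
    fix k assume "k \<in> (!) ?s ` {..<l mod q_rows P}"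
    then obtain u where u: "u < l mod q_rows P" "k = ?s ! u" by auto
    then have "k < row_of P l"
      unfolding row_of_def using sorted_wrt_nth_less[OF sd u(1)] m len by simp
    moreover have "k \<in> set ?s" using u m len by (metis nth_mem order.strict_trans)
    ultimately show "k \<in> {k \<in> J_rows P. k < row_of P l}" by simp
  qed
  moreover have "inj_on ((!) ?s) {..<l mod q_rows P}"
    using m len by (intro inj_on_nth) auto
  ultimately have "card {k \<in> J_rows P. k < row_of P l} = l mod q_rows P"
    by (simp add: card_image)
  then show "K_index P (col_of P l) (row_of P l) = l"
    unfolding K_index_def col_of_def by simp
qed

(* The part of grid_value that does not depend on the unknowns. *)
definition grid_const :: "heat_model \<Rightarrow> real \<Rightarrow> nat \<Rightarrow> nat \<Rightarrow> real" where
  "grid_const P t i j =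
    (if j = 0 then lam_G P * h_y P / (kappa_M P + lam_G P * h_y P) * Q_G P t
     else if j \<noteq> N_y P \<and> \<not> interface (row_type P j) \<and> i = 0 \<and> row_type P j = Fluid \<and> pump_on P t
     then Q_I P t else 0)"

lemma grid_value_affine:
  fixes P t i j
  defines "n \<equiv> dim_Y P"
  defines "c \<equiv> \<lambda>k. grid_value P t (unit_vec n k) i j - grid_value P t (0\<^sub>v n) i j"
  assumes P: "admissible P" and Y: "Y \<in> carrier_vec n"
    and ij: "(1 \<le> i \<and> i < N_x P \<and> j \<le> N_y P) \<or> (i \<le> N_x P \<and> j \<in> J_rows P)"
  shows "grid_value P t Y i j = (\<Sum>k<n. c k * Y $ k) + grid_const P t i j"
    and "grid_value P t (0\<^sub>v n) i j = grid_const P t i j"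
proof -
  have U: "unknown P Y i j = (\<Sum>k<n. unknown P (unit_vec n k) i j * Y $ k)"
    and Z: "unknown P (0\<^sub>v n) i j = 0"
    if "1 \<le> i" "i < N_x P" "j \<in> J_rows P" for i j
  proof -
    have lt: "K_index P i j < n" using K_index_less that n_def by blast
    then show "unknown P (0\<^sub>v n) i j = 0" unfolding unknown_def by simp
    have "(\<Sum>k<n. unknown P (unit_vec n k) i j * Y $ k)
        = (\<Sum>k<n. if k = K_index P i j then Y $ k else 0)"
      unfolding unknown_def using lt by (intro sum.cong) (auto simp: unit_vec_def)
    also have "\<dots> = Y $ K_index P i j" using lt by (simp add: sum.delta)
    finally show "unknown P Y i j = (\<Sum>k<n. unknown P (unit_vec n k) i j * Y $ k)"
      unfolding unknown_def by simp
  qed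
  note R = admissible_rows[OF P]
  have Nx: "N_x P \<ge> 3" using P unfolding admissible_def by simp
  have J1: "Suc 0 \<in> J_rows P" and JN: "N_y P - Suc 0 \<in> J_rows P"
    using R unfolding J_rows_def interface_def by auto
  have JI: "j + 1 \<in> J_rows P \<and> j - 1 \<in> J_rows P"
    if "interface (row_type P j)" "0 < j" "j < N_y P" for j
  proof -
    have "j \<noteq> 1" "j \<noteq> N_y P - 1" using that R(2,3) by (auto simp: interface_def)
    then have "1 \<le> j - 1" "j + 1 < N_y P" using that by auto
    then show ?thesis using that R(4)[of j] R(4)[of "j - 1"] unfolding J_rows_def by auto
  qed
  have grid: "\<exists>a b i1 j1 i2 j2. 1 \<le> i1 \<and> i1 < N_x P \<and> j1 \<in> J_rows P
      \<and> 1 \<le> i2 \<and> i2 < N_x P \<and> j2 \<in> J_rows P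
      \<and> (\<forall>Y. grid_value P t Y i j = a * unknown P Y i1 j1 + b * unknown P Y i2 j2 + grid_const P t i j)"
  proof -
    consider (bot) "j = 0" "1 \<le> i" "i < N_x P" | (top) "j = N_y P" "j \<noteq> 0" "1 \<le> i" "i < N_x P"
      | (lo) "row_type P j = LowerInterface" "0 < j" "j < N_y P" "1 \<le> i" "i < N_x P"
      | (up) "row_type P j = UpperInterface" "0 < j" "j < N_y P" "1 \<le> i" "i < N_x P"
      | (J) "j \<in> J_rows P" "i \<le> N_x P"
      using ij unfolding J_rows_def interface_def by force
    then show ?thesis
    proof cases
      case bot
      show ?thesis
        by (rule exI[of _ "kappa_M P / (kappa_M P + lam_G P * h_y P)"], rule exI[of _ 0],
            rule exI[of _ i], rule exI[of _ 1], rule exI[of _ i], rule exI[of _ 1])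
          (use bot J1 in \<open>simp add: grid_value_def grid_const_def\<close>)
    next
      case top
      show ?thesis
        by (rule exI[of _ 1], rule exI[of _ 0], rule exI[of _ i], rule exI[of _ "N_y P - 1"],
            rule exI[of _ i], rule exI[of _ 1])
          (use top J1 JN in \<open>simp add: grid_value_def grid_const_def\<close>)
    next
      case lo
      have "j + 1 \<in> J_rows P \<and> j - 1 \<in> J_rows P" using JI lo unfolding interface_def by blast
      then show ?thesis
        by (intro exI[of _ "psi_F P"] exI[of _ "psi_M P"] exI[of _ i] exI[of _ "j + 1"]
            exI[of _ "j - 1"])
          (use lo in \<open>simp add: grid_value_def grid_const_def\<close>)
    next
      case up
      have "j + 1 \<in> J_rows P \<and> j - 1 \<in> J_rows P" using JI up unfolding interface_def by blast
      then show ?thesis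
        by (intro exI[of _ "psi_F P"] exI[of _ "psi_M P"] exI[of _ i] exI[of _ "j - 1"]
            exI[of _ "j + 1"])
          (use up in \<open>simp add: grid_value_def grid_const_def\<close>)
    next
      case J
      let ?a = "if i = 0 \<and> row_type P j = Fluid \<and> pump_on P t then 0 else 1 :: real"
      let ?i = "if i = 0 then 1 else if i = N_x P then N_x P - 1 else i"
      show ?thesis
        by (rule exI[of _ ?a], rule exI[of _ 0], rule exI[of _ ?i], rule exI[of _ j],
            rule exI[of _ 1], rule exI[of _ j])
          (use J Nx in \<open>auto simp: grid_value_def grid_const_def J_rows_def interface_def\<close>)
    qed
  qed
  then obtain a b i1 j1 i2 j2 where 1: "1 \<le> i1" "i1 < N_x P" "j1 \<in> J_rows P"
    and 2: "1 \<le> i2" "i2 < N_x P" "j2 \<in> J_rows P"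
    and g: "\<And>Y. grid_value P t Y i j = a * unknown P Y i1 j1 + b * unknown P Y i2 j2 + grid_const P t i j"
    by blast
  show Z0: "grid_value P t (0\<^sub>v n) i j = grid_const P t i j"
    unfolding g using Z[OF 1] Z[OF 2] by simp
  have "grid_value P t Y i j = a * unknown P Y i1 j1 + b * unknown P Y i2 j2 + grid_const P t i j"
    by (rule g)
  also have "a * unknown P Y i1 j1 + b * unknown P Y i2 j2
      = (\<Sum>k<n. (a * unknown P (unit_vec n k) i1 j1 + b * unknown P (unit_vec n k) i2 j2) * Y $ k)"
    unfolding U[OF 1] U[OF 2] sum_distrib_left sum.distrib[symmetric]
    by (intro sum.cong) (auto simp: algebra_simps)
  also have "\<dots> = (\<Sum>k<n. c k * Y $ k)"
    unfolding c_def Z0 unfolding g by (intro sum.cong) auto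
  finally show "grid_value P t Y i j = (\<Sum>k<n. c k * Y $ k) + grid_const P t i j" .
qed

(* The semi-discrete scheme with the substitutions carried out is dY/dt = A(t) Y + B(t) g(t). *)
lemma rhs_vec_eq:
  assumes P: "admissible P" and t: "t \<in> {0..t_end P}" and Y: "Y \<in> carrier_vec (dim_Y P)"
  shows "rhs_vec P t Y = system_matrix P t *\<^sub>v Y + input_matrix P t *\<^sub>v input_vec P t"
proof (rule eq_vecI)
  show "dim_vec (rhs_vec P t Y)
      = dim_vec (system_matrix P t *\<^sub>v Y + input_matrix P t *\<^sub>v input_vec P t)"
    unfolding rhs_vec_def system_matrix_def input_matrix_def by simp
next
  fix l
  assume "l < dim_vec (system_matrix P t *\<^sub>v Y + input_matrix P t *\<^sub>v input_vec P t)"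
  then have l: "l < dim_Y P" unfolding input_matrix_def by simp
  define i j n where "i = col_of P l" and "j = row_of P l" and "n = dim_Y P"
  note ij = col_row_of(1-3)[OF l, folded i_def j_def]
  have jN: "0 < j" "j < N_y P" "\<not> interface (row_type P j)" using ij(3) unfolding J_rows_def by auto
  note R = admissible_rows[OF P]
  have N: "N_x P \<ge> 3" using P unfolding admissible_def by simp
  let ?c = "\<lambda>i' j' k. grid_value P t (unit_vec n k) i' j' - grid_value P t (0\<^sub>v n) i' j'"
  note G = grid_value_affine[OF P Y, folded n_def]
  have E: "grid_value P t Y (i + 1) j = (\<Sum>k<n. ?c (i + 1) j k * Y $ k) + grid_const P t (i + 1) j"
    "grid_value P t Y (i - 1) j = (\<Sum>k<n. ?c (i - 1) j k * Y $ k) + grid_const P t (i - 1) j"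
    "grid_value P t Y i (j + 1) = (\<Sum>k<n. ?c i (j + 1) k * Y $ k) + grid_const P t i (j + 1)"
    "grid_value P t Y i (j - 1) = (\<Sum>k<n. ?c i (j - 1) k * Y $ k) + grid_const P t i (j - 1)"
    "grid_value P t Y i j = (\<Sum>k<n. ?c i j k * Y $ k) + grid_const P t i j"
    by (rule G(1); insert ij jN; auto)+
  define C where "C = alpha_plus P j * grid_const P t (i + 1) j
     + alpha_minus P t j * grid_const P t (i - 1) j
     + beta P j * grid_const P t i (j + 1) + beta P j * grid_const P t i (j - 1)
     + gamma P t j * grid_const P t i j"
  have A: "system_matrix P t $$ (l, k) = alpha_plus P j * ?c (i + 1) j k
     + alpha_minus P t j * ?c (i - 1) j k + beta P j * ?c i (j + 1) k
     + beta P j * ?c i (j - 1) k + gamma P t j * ?c i j k" if "k < n" for k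
    using l that unfolding system_matrix_def rhs_vec_def scheme_rhs_def n_def i_def j_def
    by (simp add: algebra_simps)
  have "scheme_rhs P t Y i j = (\<Sum>k<n. system_matrix P t $$ (l, k) * Y $ k) + C"
  proof -
    have "(\<Sum>k<n. system_matrix P t $$ (l, k) * Y $ k) =
      (\<Sum>k<n. alpha_plus P j * (?c (i + 1) j k * Y $ k)
       + alpha_minus P t j * (?c (i - 1) j k * Y $ k) + beta P j * (?c i (j + 1) k * Y $ k)
       + beta P j * (?c i (j - 1) k * Y $ k) + gamma P t j * (?c i j k * Y $ k))"
      by (intro sum.cong refl, subst A) (simp_all add: ring_distribs mult.assoc)
    also have "\<dots> = alpha_plus P j * (\<Sum>k<n. ?c (i + 1) j k * Y $ k)
       + alpha_minus P t j * (\<Sum>k<n. ?c (i - 1) j k * Y $ k)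
       + beta P j * (\<Sum>k<n. ?c i (j + 1) k * Y $ k)
       + beta P j * (\<Sum>k<n. ?c i (j - 1) k * Y $ k) + gamma P t j * (\<Sum>k<n. ?c i j k * Y $ k)"
      unfolding sum.distrib sum_distrib_left ..
    finally have S: "(\<Sum>k<n. system_matrix P t $$ (l, k) * Y $ k) = \<dots>" .
    show ?thesis unfolding scheme_rhs_def E S C_def by (simp only: ring_distribs ac_simps)
  qed
  moreover have "(system_matrix P t *\<^sub>v Y) $ l = (\<Sum>k<n. system_matrix P t $$ (l, k) * Y $ k)"
    using l Y unfolding system_matrix_def n_def
    by (auto simp: scalar_prod_def lessThan_atLeast0 intro!: sum.cong)
  moreover have "(input_matrix P t *\<^sub>v input_vec P t) $ l = C"
  proof -
    have B: "(input_matrix P t *\<^sub>v input_vec P t) $ l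
        = input_matrix P t $$ (l, 0) * (if pump_on P t then Q_I P t else 0)
          + input_matrix P t $$ (l, 1) * Q_G P t"
      using l unfolding input_matrix_def input_vec_def
      by (simp add: scalar_prod_def numeral_2_eq_2)
    have c: "grid_const P t (i + 1) j = 0" "grid_const P t i (j + 1) = 0" "grid_const P t i j = 0"
      using ij jN unfolding grid_const_def by auto
    have cm: "alpha_minus P t j * grid_const P t (i - 1) j
        = input_matrix P t $$ (l, 0) * (if pump_on P t then Q_I P t else 0)"
      using l ij jN unfolding input_matrix_def grid_const_def alpha_minus_def i_def[symmetric]
      by (auto simp: i_def[symmetric] j_def[symmetric] pump_on_def)
    have bm: "beta P j * grid_const P t i (j - 1) = input_matrix P t $$ (l, 1) * Q_G P t"
    proof (cases "j = 1")
      case True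
      then show ?thesis using l R(2) unfolding input_matrix_def grid_const_def beta_def
        by (simp add: j_def[symmetric] mult_ac)
    next
      case False
      then have "grid_const P t i (j - 1) = 0" using ij(1) jN unfolding grid_const_def by auto
      then show ?thesis using l False unfolding input_matrix_def by (simp add: j_def[symmetric])
    qed
    show ?thesis unfolding B C_def c cm bm by simp
  qed
  moreover have "l < dim_vec (input_matrix P t *\<^sub>v input_vec P t)"
    using l unfolding input_matrix_def by simp
  ultimately show "rhs_vec P t Y $ l
      = (system_matrix P t *\<^sub>v Y + input_matrix P t *\<^sub>v input_vec P t) $ l"
    using l unfolding rhs_vec_def i_def j_def by simp
qed

end

theory Submission
  imports Defs
begin

text \<open>
  The system matrix $A$ has nonnegative off-diagonal entries, because a neighbouring unknown enters
  an equation only through a coefficient \<open>alpha_plus\<close>, \<open>alpha_minus\<close> or \<open>beta\<close>, possibly multiplied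
  by one of the weights of the interface and ground conditions.  Such a matrix is stable as soon as
  there is a positive vector $w$ with $A w < 0$ in every component: after scaling the unknowns by
  $w$, the matrix is strictly diagonally dominant with a negative diagonal, and every Gershgorin
  disc lies in the open left half plane (\<open>stable_if_strict_supersolution\<close>).

  The row sums of $A$ vanish away from the ground and the active inlet, so $w = 1$ does not suffice.
  Dissipation through the ground, however, is felt in every row, and a vector that depends on the row
  alone makes this quantitative: $w_{ij} = K - r^j$ with $r$ small and $K$ large.  It increases with
  the distance from the ground and flattens out so fast that in each equation the loss to the row
  below exceeds the gain from the row above, even when the row below is an interface whose value
  partly mirrors the row itself (\<open>value_below_bound\<close>).  In horizontal direction $w$ is constant, so
  diffusion and transport contribute nothing, except for a further loss at an active inlet.  The same
  vector thus works whether the pump is on or off.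
\<close>

section \<open>Matrices with nonnegative off-diagonal entries\<close>

text \<open>
  This is Gershgorin's argument for the matrix scaled by $w$, applied to the row in which
  $|v_l| / w_l$ is largest for an eigenvector $v$: there $|z - a_{ll}| < -a_{ll}$.
\<close>

lemma stable_if_strict_supersolution:
  fixes A :: "real mat" and w :: "real vec"
  assumes A: "A \<in> carrier_mat n n" and w: "w \<in> carrier_vec n"
    and offdiag: "\<And>l k. l < n \<Longrightarrow> k < n \<Longrightarrow> l \<noteq> k \<Longrightarrow> A $$ (l, k) \<ge> 0"
    and w_pos: "\<And>l. l < n \<Longrightarrow> w $ l > 0"
    and strict: "\<And>l. l < n \<Longrightarrow> (A *\<^sub>v w) $ l < 0"
  shows "stable_matrix A"
  unfolding stable_matrix_def
proof
  fix z assume "z \<in> spectrum (map_mat complex_of_real A)"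
  then obtain v where v: "v \<in> carrier_vec n" "v \<noteq> 0\<^sub>v n"
    and ev: "map_mat complex_of_real A *\<^sub>v v = z \<cdot>\<^sub>v v"
    using A unfolding spectrum_def eigenvalue_def eigenvector_def by auto
  obtain k where k: "k < n" "v $ k \<noteq> 0" using v by (metis carrier_vecD eq_vecI index_zero_vec)
  define ratio where "ratio l = cmod (v $ l) / w $ l" for l
  have "Max (ratio ` {..<n}) \<in> ratio ` {..<n}" using k by (intro Max_in) auto
  then obtain l where l: "l < n" and max_l: "Max (ratio ` {..<n}) = ratio l" by auto
  have ratio_le: "ratio k' \<le> ratio l" if "k' < n" for k'
    unfolding max_l[symmetric] using that by (intro Max_ge) auto
  have "ratio k > 0" unfolding ratio_def using k w_pos by simp
  then have ratio_pos: "ratio l > 0" using ratio_le[OF k(1)] by linarith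
  have norm_le: "cmod (v $ k') \<le> ratio l * w $ k'" if "k' < n" for k'
    using ratio_le[OF that] w_pos[OF that] unfolding ratio_def[of k'] by (simp add: divide_le_eq)
  have norm_l: "cmod (v $ l) = ratio l * w $ l"
    using w_pos[OF l] unfolding ratio_def by simp
  have split: "(\<Sum>k'<n. g k') = g l + (\<Sum>k'\<in>{..<n} - {l}. g k')"
    for g :: "nat \<Rightarrow> 'x :: comm_monoid_add"
    using l by (intro sum.remove) auto
  have "(map_mat complex_of_real A *\<^sub>v v) $ l = (\<Sum>k'<n. complex_of_real (A $$ (l, k')) * v $ k')"
    using l A v by (auto simp: scalar_prod_def lessThan_atLeast0 intro!: sum.cong)
  then have "z * v $ l = (\<Sum>k'<n. complex_of_real (A $$ (l, k')) * v $ k')"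
    using ev l v by simp
  then have row: "(z - A $$ (l, l)) * v $ l
      = (\<Sum>k'\<in>{..<n} - {l}. complex_of_real (A $$ (l, k')) * v $ k')"
    unfolding split by (simp add: algebra_simps)
  have "(A *\<^sub>v w) $ l = (\<Sum>k'<n. A $$ (l, k') * w $ k')"
    using l A w by (auto simp: scalar_prod_def lessThan_atLeast0 intro!: sum.cong)
  then have w_row: "(\<Sum>k'\<in>{..<n} - {l}. A $$ (l, k') * w $ k') < - A $$ (l, l) * w $ l"
    using strict[OF l] unfolding split by simp
  have "cmod (z - A $$ (l, l)) * cmod (v $ l)
      \<le> (\<Sum>k'\<in>{..<n} - {l}. cmod (complex_of_real (A $$ (l, k')) * v $ k'))"
    unfolding norm_mult[symmetric] row by (rule norm_sum)
  also have "\<dots> \<le> (\<Sum>k'\<in>{..<n} - {l}. A $$ (l, k') * (ratio l * w $ k'))"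
    using offdiag l norm_le by (intro sum_mono) (auto simp: norm_mult intro!: mult_left_mono)
  also have "\<dots> = ratio l * (\<Sum>k'\<in>{..<n} - {l}. A $$ (l, k') * w $ k')"
    unfolding sum_distrib_left by (simp add: mult_ac)
  also have "\<dots> < ratio l * (- A $$ (l, l) * w $ l)"
    using w_row ratio_pos by (rule mult_strict_left_mono)
  also have "\<dots> = - A $$ (l, l) * cmod (v $ l)" unfolding norm_l by simp
  finally have "cmod (z - A $$ (l, l)) < - A $$ (l, l)"
    by (rule mult_right_less_imp_less) simp
  then show "Re z < 0" using complex_Re_le_cmod[of "z - A $$ (l, l)"] by simp
qed

section \<open>The homogeneous part of the scheme\<close>

text \<open>
  Subtracting the values for the zero vector removes the inputs $Q^I$ and $Q^G$ and leaves the linear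
  part, in which the entries of the system matrix and its products with vectors can be computed.
\<close>

definition hom_value :: "heat_model \<Rightarrow> real \<Rightarrow> real vec \<Rightarrow> nat \<Rightarrow> nat \<Rightarrow> real" where
  "hom_value P t Y i j = grid_value P t Y i j - grid_value P t (0\<^sub>v (dim_Y P)) i j"

definition hom_rhs :: "heat_model \<Rightarrow> real \<Rightarrow> real vec \<Rightarrow> nat \<Rightarrow> nat \<Rightarrow> real" where
  "hom_rhs P t Y i j =
     alpha_plus P j * hom_value P t Y (i + 1) j
     + alpha_minus P t j * hom_value P t Y (i - 1) j
     + beta P j * hom_value P t Y i (j + 1)
     + beta P j * hom_value P t Y i (j - 1)
     + gamma P t j * hom_value P t Y i j"

lemma scheme_rhs_diff:
  "scheme_rhs P t Y i j - scheme_rhs P t (0\<^sub>v (dim_Y P)) i j = hom_rhs P t Y i j"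
  unfolding scheme_rhs_def hom_rhs_def hom_value_def by (simp add: algebra_simps)

lemma system_matrix_entry:
  assumes "l < dim_Y P" "k < dim_Y P"
  shows "system_matrix P t $$ (l, k)
    = hom_rhs P t (unit_vec (dim_Y P) k) (col_of P l) (row_of P l)"
  using assms by (simp add: system_matrix_def rhs_vec_def scheme_rhs_diff)

lemma system_matrix_mult_vec:
  assumes P: "admissible P" and t: "t \<in> {0..t_end P}"
    and Y: "Y \<in> carrier_vec (dim_Y P)" and l: "l < dim_Y P"
  shows "(system_matrix P t *\<^sub>v Y) $ l = hom_rhs P t Y (col_of P l) (row_of P l)"
proof -
  let ?b = "input_matrix P t *\<^sub>v input_vec P t"
  have dim_b: "dim_vec ?b = dim_Y P" by (simp add: input_matrix_def)
  have A: "system_matrix P t \<in> carrier_mat (dim_Y P) (dim_Y P)"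
    by (simp add: system_matrix_def)
  have "rhs_vec P t Y $ l = (system_matrix P t *\<^sub>v Y) $ l + ?b $ l"
    using l dim_b by (simp add: rhs_vec_eq[OF P t Y])
  moreover have "rhs_vec P t (0\<^sub>v (dim_Y P)) $ l = ?b $ l"
    using l dim_b A by (simp add: rhs_vec_eq[OF P t zero_carrier_vec])
  ultimately show ?thesis
    using l by (simp add: rhs_vec_def flip: scheme_rhs_diff)
qed

lemma h_pos:
  assumes "admissible P"
  shows "h_x P > 0" "h_y P > 0"
  using assms admissible_rows(1)[OF assms] by (auto simp: admissible_def h_x_def h_y_def)

lemma a_pos:
  assumes "admissible P"
  shows "a_M P > 0" "a_F P > 0"
  using assms by (auto simp: admissible_def a_M_def a_F_def)

lemma psi_pos:
  assumes "admissible P"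
  shows "psi_F P > 0" "psi_M P > 0"
  using assms by (auto simp: admissible_def psi_M_def psi_F_def field_simps)

lemma ground_weight:
  assumes "admissible P"
  shows "0 < kappa_M P / (kappa_M P + lam_G P * h_y P)"
    and "kappa_M P / (kappa_M P + lam_G P * h_y P) < 1"
  using assms h_pos[OF assms]
  by (auto simp: admissible_def intro!: divide_pos_pos add_pos_pos)
    (smt (verit) divide_less_eq_1 mult_pos_pos)

lemma coefficients_nonneg:
  assumes P: "admissible P" and t: "t \<in> {0..t_end P}"
  shows "alpha_plus P j \<ge> 0" "alpha_minus P t j \<ge> 0" "beta P j > 0"
proof -
  have "v_0 P t \<ge> 0" using P t unfolding admissible_def by fastforce
  then show "alpha_plus P j \<ge> 0" "alpha_minus P t j \<ge> 0" "beta P j > 0"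
    using h_pos[OF P] a_pos[OF P] by (auto simp: alpha_plus_def alpha_minus_def beta_def)
qed

lemma gamma_balance:
  "gamma P t j = - (alpha_plus P j + alpha_minus P t j + 2 * beta P j)"
  by (simp add: gamma_def alpha_plus_def alpha_minus_def beta_def algebra_simps)

text \<open>
  The linear part of every boundary and interface substitution has nonnegative weights.  The premise
  compares with the zero vector, instead of assuming $Y \<ge> 0$, so that it holds for unit vectors
  without regard to whether the index is in range: outside it all vectors of one dimension agree.
\<close>

lemma hom_value_nonneg:
  assumes P: "admissible P"
    and Y: "\<And>i j. unknown P Y i j \<ge> unknown P (0\<^sub>v (dim_Y P)) i j"
  shows "hom_value P t Y i j \<ge> 0"
proof -
  let ?u = "unknown P Y" and ?z = "unknown P (0\<^sub>v (dim_Y P))"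
  have if_mono_le: "(if c then a else b) \<le> (if c then a' else b')" if "a \<le> a'" "b \<le> b'"
    for c and a a' b b' :: real
    using that by simp
  have "a * ?z i j \<le> a * ?u i j" if "a > 0" for a i j
    using Y that by (intro mult_left_mono) auto
  note psi = this[OF psi_pos(1)[OF P]] this[OF psi_pos(2)[OF P]] this[OF ground_weight(1)[OF P]]
  have "grid_value P t (0\<^sub>v (dim_Y P)) i j \<le> grid_value P t Y i j"
    unfolding grid_value_def by (intro if_mono_le add_mono psi Y order_refl)
  then show ?thesis by (simp add: hom_value_def)
qed

lemma vec_index_out_of_range:
  assumes "\<not> m < n"
  shows "vec n f $ m = vec n g $ m"
  using assms by transfer (simp add: mk_vec_def)

lemma system_matrix_offdiag_nonneg:
  assumes P: "admissible P" and t: "t \<in> {0..t_end P}"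
    and lk: "l < dim_Y P" "k < dim_Y P" "l \<noteq> k"
  shows "system_matrix P t $$ (l, k) \<ge> 0"
proof -
  let ?e = "unit_vec (dim_Y P) k :: real vec" and ?i = "col_of P l" and ?j = "row_of P l"
  have "?e $ m \<ge> 0\<^sub>v (dim_Y P) $ m" for m
  proof (cases "m < dim_Y P")
    case False
    have "?e $ m = (0\<^sub>v (dim_Y P) :: real vec) $ m"
      unfolding unit_vec_def zero_vec_def by (rule vec_index_out_of_range[OF False])
    then show ?thesis by simp
  qed (simp add: unit_vec_def)
  then have "unknown P ?e i j \<ge> unknown P (0\<^sub>v (dim_Y P)) i j" for i j
    by (simp add: unknown_def)
  then have nonneg: "hom_value P t ?e i j \<ge> 0" for i j
    using P by (intro hom_value_nonneg)
  note ij = col_row_of[OF lk(1)]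
  have "hom_value P t ?e ?i ?j = 0"
    using ij lk by (auto simp: hom_value_def grid_value_def unknown_def J_rows_def)
  then show ?thesis
    unfolding system_matrix_entry[OF lk(1,2)] hom_rhs_def
    using nonneg coefficients_nonneg[OF P t] by (simp add: less_imp_le)
qed

section \<open>A strict supersolution\<close>

lemma row_of_K_index:
  assumes i: "1 \<le> i" "i < N_x P" and j: "j \<in> J_rows P"
  shows "row_of P (K_index P i j) = j"
proof -
  define pos where "pos j = card {k \<in> J_rows P. k < j}" for j
  have pos_mono: "pos a < pos b" if "a < b" "a \<in> J_rows P" for a b
    unfolding pos_def using that by (intro psubset_card_mono) auto
  have pos_less: "pos a < q_rows P" if "a \<in> J_rows P" for a
    unfolding pos_def q_rows_def using that by (intro psubset_card_mono) auto
  let ?l = "K_index P i j"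
  note c = col_row_of[OF K_index_less[OF i j]]
  have mod: "K_index P i' a mod q_rows P = pos a" if "a \<in> J_rows P" for i' a
    using pos_less[OF that] by (simp add: K_index_def pos_def)
  have "pos (row_of P ?l) = pos j"
    using mod[OF c(3)] mod[OF j] c(4) by metis
  then show ?thesis
    using pos_mono c(3) j by (metis less_irrefl linorder_neqE_nat)
qed

definition row_vec :: "heat_model \<Rightarrow> (nat \<Rightarrow> real) \<Rightarrow> real vec" where
  "row_vec P f = vec (dim_Y P) (\<lambda>l. f (row_of P l))"

lemma unknown_row_vec:
  assumes "1 \<le> i" "i < N_x P" "j \<in> J_rows P"
  shows "unknown P (row_vec P f) i j = f j" "unknown P (0\<^sub>v (dim_Y P)) i j = 0"
  using K_index_less[OF assms] row_of_K_index[OF assms]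
  by (simp_all add: unknown_def row_vec_def)

lemma interface_neighbours:
  assumes P: "admissible P" and j: "0 < j" "j < N_y P" "interface (row_type P j)"
  shows "j + 1 \<in> J_rows P" "j - 1 \<in> J_rows P" "j \<ge> 2"
proof -
  note R = admissible_rows[OF P]
  have "j \<noteq> 1" "j \<noteq> N_y P - 1" using j R(2,3) by (auto simp: interface_def)
  then have *: "1 \<le> j - 1" "j + 1 < N_y P" using j by auto
  then show "j + 1 \<in> J_rows P" "j - 1 \<in> J_rows P" "j \<ge> 2"
    using j R(4)[of j] R(4)[of "j - 1"] unfolding J_rows_def by auto
qed

text \<open>
  The profile is $f(j) = K - r^j$.  The bound on $r^2$ by the interface weights is what the rows above
  an interface need, the one on $r$ serves the remaining inner rows, and the condition \<open>ground\<close> is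
  $f_0 < K - 2 r$ for the value $f_0$ that the ground condition assigns to row $0$.
\<close>

context
  fixes P :: heat_model and t :: real and f :: "nat \<Rightarrow> real" and K r :: real
  assumes P: "admissible P" and t: "t \<in> {0..t_end P}"
    and r_pos: "0 < r" and r_half: "r < 1 / 2"
    and r_F: "2 * r\<^sup>2 < psi_F P" and r_M: "2 * r\<^sup>2 < psi_M P"
    and K: "r < K"
    and ground: "kappa_M P / (kappa_M P + lam_G P * h_y P) * (K - r) < K - 2 * r"
    and f_def: "f = (\<lambda>j. K - r ^ j)"
begin

lemma profile_pos:
  assumes "1 \<le> j"
  shows "f j > 0"
proof -
  have "r ^ j \<le> r ^ 1" using assms r_pos r_half by (intro power_decreasing) auto
  then show ?thesis using K by (simp add: f_def)
qed

lemma value_centre: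
  assumes "1 \<le> i" "i < N_x P" "j \<in> J_rows P"
  shows "hom_value P t (row_vec P f) i j = f j"
  using assms by (auto simp: hom_value_def grid_value_def J_rows_def unknown_row_vec)

text \<open>
  Equality fails only for $i = 0$ at an active inlet, where the homogeneous value is zero.
\<close>

lemma value_horizontal:
  assumes i: "i \<le> N_x P" and j: "j \<in> J_rows P"
  shows "hom_value P t (row_vec P f) i j \<le> f j"
proof -
  have N: "3 \<le> N_x P" using P by (simp add: admissible_def)
  have "f j > 0" using j by (intro profile_pos) (simp add: J_rows_def)
  moreover have "j \<noteq> 0" "j \<noteq> N_y P" "row_type P j \<noteq> LowerInterface"
      "row_type P j \<noteq> UpperInterface"
    using j by (auto simp: J_rows_def)
  ultimately show ?thesis
    using i j N by (auto simp: hom_value_def grid_value_def unknown_row_vec)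
qed

text \<open>
  Above the row all that matters is that the profile never exceeds its limit $K$: the gain is at most
  $K - f(j) = r^j$.
\<close>

lemma value_above_bound:
  assumes i: "1 \<le> i" "i < N_x P" and j: "j \<in> J_rows P"
  shows "hom_value P t (row_vec P f) i (j + 1) \<le> K"
proof -
  have f_le: "f k \<le> K" for k using r_pos by (simp add: f_def)
  have jN: "1 \<le> j" "j < N_y P" using j by (auto simp: J_rows_def)
  have convex: "psi_F P * f a + psi_M P * f b \<le> K" for a b
  proof -
    have "psi_F P * f a + psi_M P * f b \<le> psi_F P * K + psi_M P * K"
      using psi_pos[OF P] f_le by (intro add_mono mult_left_mono) auto
    then show ?thesis by (simp add: psi_M_def left_diff_distrib)
  qed
  consider (top) "j + 1 = N_y P" | (inner) "j + 1 \<in> J_rows P"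
    | (interf) "j + 1 < N_y P" "interface (row_type P (j + 1))"
    using jN by (fastforce simp: J_rows_def)
  then show ?thesis
  proof cases
    case top
    then have "N_y P - Suc 0 = j" by simp
    then show ?thesis
      using top i j f_le by (simp add: hom_value_def grid_value_def unknown_row_vec)
  next
    case inner
    then show ?thesis using i f_le by (simp add: value_centre)
  next
    case interf
    note n = interface_neighbours[OF P _ interf]
    then show ?thesis
      using interf i j convex
      by (auto simp: hom_value_def grid_value_def unknown_row_vec interface_def)
  qed
qed

text \<open>
  Below the row the loss $f(j) - f(j-1)$, or its analogue at an interface or at the ground, must
  exceed the possible gain $r^j$; in terms of the value below this is the bound $K - 2 r^j$.  For a
  neighbouring row of unknowns it means $2 r < 1$.  At an interface a fraction of the value is that
  of row $j$ itself, but the remaining weight on row $j - 2$ multiplies $r^{j-2}$, which dominates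
  $2 r^j$ when $2 r^2$ is below that weight.
\<close>

lemma value_below_bound:
  assumes i: "1 \<le> i" "i < N_x P" and j: "j \<in> J_rows P"
  shows "hom_value P t (row_vec P f) i (j - 1) < K - 2 * r ^ j"
proof -
  have jN: "1 \<le> j" "j < N_y P" using j by (auto simp: J_rows_def)
  consider (bottom) "j = 1" | (inner) "j - 1 \<in> J_rows P"
    | (interf) "0 < j - 1" "j - 1 < N_y P" "interface (row_type P (j - 1))"
    using jN by (fastforce simp: J_rows_def)
  then show ?thesis
  proof cases
    case bottom
    then show ?thesis
      using ground i j by (simp add: hom_value_def grid_value_def unknown_row_vec f_def)
  next
    case inner
    have "r ^ j = r * r ^ (j - 1)" using jN by (simp add: power_eq_if)
    also have "\<dots> < 1 / 2 * r ^ (j - 1)"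
      using r_pos r_half by (intro mult_strict_right_mono) auto
    finally have "f (j - 1) < K - 2 * r ^ j" by (simp add: f_def)
    then show ?thesis unfolding value_centre[OF i inner] .
  next
    case interf
    note n = interface_neighbours[OF P interf]
    have j2: "2 \<le> j" using n by simp
    have up: "j - 1 + 1 = j" and down: "j - 1 - 1 = j - 2" using j2 by auto
    define s where "s = r ^ (j - 2)"
    have s: "s > 0" using r_pos by (simp add: s_def)
    have rj: "r ^ j = r\<^sup>2 * s" using j2 unfolding s_def by (metis le_add_diff_inverse power_add)
    have key: "b * f j + c * f (j - 2) < K - 2 * r ^ j"
      if "b + c = 1" "b > 0" "2 * r\<^sup>2 < c" for b c
    proof -
      have "b * f j + c * f (j - 2) = (b + c) * K - b * r ^ j - c * s"
        by (simp add: f_def s_def algebra_simps)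
      also have "\<dots> = K - b * r ^ j - c * s" using that by simp
      finally have "b * f j + c * f (j - 2) = K - b * r ^ j - c * s" .
      moreover have "2 * r ^ j < c * s"
        using mult_strict_right_mono[OF that(3) s] by (simp add: rj mult.assoc)
      moreover have "b * r ^ j > 0" using that(2) r_pos by simp
      ultimately show ?thesis by linarith
    qed
    note p = psi_pos[OF P]
    have nJ: "j - 2 \<in> J_rows P" using n(2) down by simp
    have ne: "j - 1 \<noteq> 0" "j - 1 \<noteq> N_y P" using interf by auto
    consider "row_type P (j - 1) = LowerInterface" | "row_type P (j - 1) = UpperInterface"
      using interf(3) by (auto simp: interface_def)
    then show ?thesis
    proof cases
      case 1
      have "hom_value P t (row_vec P f) i (j - 1) = psi_F P * f j + psi_M P * f (j - 2)"
        unfolding hom_value_def grid_value_def up down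
        using 1 ne unknown_row_vec[OF i j] unknown_row_vec[OF i nJ] by simp
      then show ?thesis using key[of "psi_F P" "psi_M P"] p r_M by (simp add: psi_M_def)
    next
      case 2
      have "hom_value P t (row_vec P f) i (j - 1) = psi_M P * f j + psi_F P * f (j - 2)"
        unfolding hom_value_def grid_value_def up down
        using 2 ne unknown_row_vec[OF i j] unknown_row_vec[OF i nJ] by simp
      then show ?thesis using key[of "psi_M P" "psi_F P"] p r_F by (simp add: psi_M_def)
    qed
  qed
qed

lemma hom_rhs_row_vec_neg:
  assumes i: "1 \<le> i" "i < N_x P" and j: "j \<in> J_rows P"
  shows "hom_rhs P t (row_vec P f) i j < 0"
proof -
  let ?h = "hom_value P t (row_vec P f)"
  note c = coefficients_nonneg[OF P t, of j]
  have "alpha_plus P j * ?h (i + 1) j \<le> alpha_plus P j * f j"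
    using c(1) i j by (intro mult_left_mono value_horizontal) auto
  moreover have "alpha_minus P t j * ?h (i - 1) j \<le> alpha_minus P t j * f j"
    using c(2) i j by (intro mult_left_mono value_horizontal) auto
  moreover have "?h i (j + 1) + ?h i (j - 1) < 2 * f j"
    using value_above_bound[OF i j] value_below_bound[OF i j] by (simp add: f_def)
  then have "beta P j * (?h i (j + 1) + ?h i (j - 1)) < beta P j * (2 * f j)"
    using c(3) by (rule mult_strict_left_mono)
  ultimately show ?thesis
    unfolding hom_rhs_def value_centre[OF i j] gamma_balance by (simp add: algebra_simps)
qed

lemma stable_from_profile: "stable_matrix (system_matrix P t)"
proof (rule stable_if_strict_supersolution)
  show "system_matrix P t \<in> carrier_mat (dim_Y P) (dim_Y P)" by (simp add: system_matrix_def)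
  show w: "row_vec P f \<in> carrier_vec (dim_Y P)" by (simp add: row_vec_def)
  show "system_matrix P t $$ (l, k) \<ge> 0" if "l < dim_Y P" "k < dim_Y P" "l \<noteq> k" for l k
    using system_matrix_offdiag_nonneg[OF P t that] .
  show "row_vec P f $ l > 0" if "l < dim_Y P" for l
    using col_row_of(3)[OF that] that by (auto simp: row_vec_def J_rows_def intro: profile_pos)
  show "(system_matrix P t *\<^sub>v row_vec P f) $ l < 0" if "l < dim_Y P" for l
    unfolding system_matrix_mult_vec[OF P t w that]
    using col_row_of[OF that] by (intro hom_rhs_row_vec_neg)
qed

end

theorem theorem3p2:
  fixes P :: heat_model and t :: real
  assumes "admissible P" and "t \<in> {0..t_end P}"
  shows "system_matrix P t \<in> carrier_mat (dim_Y P) (dim_Y P)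
         \<and> stable_matrix (system_matrix P t)"
proof
  show "system_matrix P t \<in> carrier_mat (dim_Y P) (dim_Y P)" by (simp add: system_matrix_def)
  define p where "p = min (psi_F P) (psi_M P)"
  have p: "0 < p" "p \<le> 1 / 2" "p \<le> psi_F P" "p \<le> psi_M P"
    using psi_pos[OF assms(1)] by (auto simp: p_def psi_M_def min_def)
  define \<theta> where "\<theta> = kappa_M P / (kappa_M P + lam_G P * h_y P)"
  have \<theta>: "\<theta> < 1" using ground_weight[OF assms(1)] by (simp add: \<theta>_def)
  (* This gives r \<le> 1/4, and 2 * r\<^sup>2 = p\<^sup>2 / 2 is less than p. *)
  define r where "r = p / 2"
  define K where "K = r + 2 * r / (1 - \<theta>)"
  have r: "0 < r" "r < 1 / 2" using p by (auto simp: r_def)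
  have "2 * r\<^sup>2 = p * (p / 2)" by (simp add: r_def power2_eq_square)
  also have "\<dots> < p * 1" using p by (intro mult_strict_left_mono) auto
  finally have r2: "2 * r\<^sup>2 < p" by simp
  have "K > r" using r \<theta> by (simp add: K_def)
  (* K is chosen so that (1 - \<theta>) * (K - r) = 2 * r, twice what the
     ground condition asks for. *)
  moreover have "(1 - \<theta>) * (K - r) = 2 * r" using \<theta> by (simp add: K_def)
  then have "\<theta> * (K - r) < K - 2 * r" using r by (simp add: algebra_simps)
  ultimately show "stable_matrix (system_matrix P t)"
    using assms r r2 p by (intro stable_from_profile[of P t r K]) (auto simp: \<theta>_def)
qed

end
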